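(* Let $X$ be a topological space, let $Y$ be a convex set in a topological vector space and let $Z$ be a topological vector space. Let $T\in KKM(Y,X)$ be such that, for each compact subset $A$ of $Y$, $\overline{T(A)}$ is compact. Let $F:X\times Z\to 2^{Z}\setminus\{\emptyset\}$, $Q:Y\to 2^{Z}$ and $C:X\to 2^{Z}$ be such that, for each $x\in X$, $C(x)$ is a pointed, closed and convex cone with $\operatorname{int}C(x)\neq\emptyset$. Assume that $T$ is properly quasi-convex w.r.t. $G$, where $G:Y\to 2^{X}$ is defined by $G(y)=\{x\in X:P(x)\cap Q(y)=\emptyset\}$ for each $y\in Y$, and $P:X\to 2^{Z}$ is defined by $P(x)=\{z\in Z:F(x,z)\subseteq-\operatorname{int}C(x)\}$ for each $x\in X$. Then, for each $y\in Y$, there exists $x^{\ast}\in X$ such that $F(x^{\ast},z)\nsubseteq-\operatorname{int}C(x^{\ast})$ for each $z\in Q(y)$.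
   Context: A correspondence $T:Y\to 2^{X}$ assigns to each $y\in Y$ a subset $T(y)\subset X$; $T(B)=\bigcup_{y\in B}T(y)$ for $B\subset Y$. $\operatorname{co}$ denotes the convex hull. Given $T,H:Y\to 2^{X}$, $H$ is a generalized KKM mapping w.r.t. $T$ if $T(\operatorname{co}B)\subset H(B)$ for each finite $B\subset Y$. $KKM(Y,X)$ is the set of $T:Y\to 2^{X}$ having the KKM property: for every $H:Y\to 2^{X}$ which is a generalized KKM mapping w.r.t. $T$, the family $\{\overline{H(y)}:y\in Y\}$ has the finite intersection property. For $T,G:Y\to 2^{X}$, $T$ is properly quasi-convex w.r.t. $G$ if for each integer $n\ge 2$, all $y_1,\dots,y_n\in Y$ and each $y\in\operatorname{co}\{y_1,\dots,y_n\}$, there exists $i_0\in\{1,\dots,n\}$ such that $T(y)\subset G(y_{i_0})$. *)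

theory Defs
  imports "HOL-Analysis.Analysis"
begin

text \<open>
  No separation axiom is assumed. Joint continuity of addition is part of
  \<^class>\<open>topological_ab_group_add\<close>.
\<close>

class real_tvs = real_vector + topological_ab_group_add +
  assumes tendsto_scaleR_Pair:
    "LIM p (nhds c \<times>\<^sub>F nhds x). fst p *\<^sub>R snd p :> nhds (c *\<^sub>R x)"

instance real_normed_vector \<subseteq> real_tvs
proof
  fix c :: real and x :: 'a
  show "LIM p (nhds c \<times>\<^sub>F nhds x). fst p *\<^sub>R snd p :> nhds (c *\<^sub>R x)"
    by (intro tendsto_scaleR) (auto intro: filterlim_fst filterlim_snd)
qed

definition finite_intersection_property :: "'a set set \<Rightarrow> bool" where
  "finite_intersection_property \<A> \<longleftrightarrow>
     (\<forall>\<F>. \<F> \<subseteq> \<A> \<and> finite \<F> \<and> \<F> \<noteq> {} \<longrightarrow> \<Inter>\<F> \<noteq> {})"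

definition generalized_KKM ::
    "'y::real_vector set \<Rightarrow> ('y \<Rightarrow> 'x set) \<Rightarrow> ('y \<Rightarrow> 'x set) \<Rightarrow> bool" where
  "generalized_KKM Y T H \<longleftrightarrow>
     (\<forall>B. finite B \<and> B \<subseteq> Y \<longrightarrow> \<Union>(T ` (convex hull B)) \<subseteq> \<Union>(H ` B))"

definition KKM :: "'y::real_vector set \<Rightarrow> 'x topology \<Rightarrow> ('y \<Rightarrow> 'x set) set" where
  "KKM Y X = {T \<in> Y \<rightarrow> Pow (topspace X).
     \<forall>H \<in> Y \<rightarrow> Pow (topspace X). generalized_KKM Y T H \<longrightarrow>
       finite_intersection_property ((\<lambda>y. X closure_of H y) ` Y)}"

definition properly_quasi_convex_wrt ::
    "'y::real_vector set \<Rightarrow> ('y \<Rightarrow> 'x set) \<Rightarrow> ('y \<Rightarrow> 'x set) \<Rightarrow> bool" where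
  "properly_quasi_convex_wrt Y T G \<longleftrightarrow>
     (\<forall>n\<ge>2. \<forall>ys :: nat \<Rightarrow> 'y. ys \<in> {1..n} \<rightarrow> Y \<longrightarrow>
        (\<forall>y \<in> convex hull (ys ` {1..n}). \<exists>i\<in>{1..n}. T y \<subseteq> G (ys i)))"

definition pointed :: "'z::real_vector set \<Rightarrow> bool" where
  "pointed K \<longleftrightarrow> K \<inter> uminus ` K = {0}"

end

theory Submission
  imports Defs
begin

text \<open>
  The conclusion speaks of one point y at a time and says exactly that G y is nonempty. It
  therefore suffices to find a nonempty set inside G y, and T y is one: proper quasi-convexity,
  read on a constant family, gives T y \<subseteq> G y (\<open>properly_quasi_convex_wrt_imp_subset\<close>), and
  a mapping with the KKM property has no empty value (\<open>KKM_imp_nonempty\<close>).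
\<close>

text \<open>
  If T y were empty, changing a constant mapping with value the whole space to be empty at y alone
  would still give a generalized KKM mapping: the only nonempty finite set on which its union is
  not everything is {y}, whose convex hull T sends to the empty set. But a family with an empty
  member lacks the finite intersection property.
\<close>

lemma KKM_imp_nonempty:
  assumes "convex Y" and T: "T \<in> KKM Y X" and "y \<in> Y"
  shows "T y \<noteq> {}"
proof
  assume empty: "T y = {}"
  define H where "H = (\<lambda>_. topspace X)(y := {})"
  have T_sub: "T u \<subseteq> topspace X" if "u \<in> Y" for u
    using T that by (auto simp: KKM_def)
  have "\<Union>(T ` (convex hull B)) \<subseteq> \<Union>(H ` B)" if B: "B \<subseteq> Y" for B
  proof (cases "B \<subseteq> {y}")
    case True
    then have "B = {} \<or> B = {y}" by blast
    then show ?thesis using empty by auto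
  next
    case False
    then obtain b where "b \<in> B" "b \<noteq> y" by blast
    then have "topspace X \<subseteq> \<Union>(H ` B)" by (auto simp: H_def)
    moreover have "convex hull B \<subseteq> Y"
      using B \<open>convex Y\<close> by (rule hull_minimal)
    ultimately show ?thesis using T_sub by blast
  qed
  then have "generalized_KKM Y T H"
    by (simp add: generalized_KKM_def)
  moreover have "H \<in> Y \<rightarrow> Pow (topspace X)"
    by (simp add: H_def)
  ultimately have "finite_intersection_property ((\<lambda>u. X closure_of H u) ` Y)"
    using T by (auto simp: KKM_def)
  moreover have "{} \<in> (\<lambda>u. X closure_of H u) ` Y"
    using \<open>y \<in> Y\<close> by (intro image_eqI[of _ _ y]) (simp_all add: H_def)
  ultimately have "\<Inter>{{}::'b set} \<noteq> {}"
    unfolding finite_intersection_property_def by blast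
  then show False by simp
qed

text \<open>
  The definition asks for at least two points, but they may coincide.
\<close>

lemma properly_quasi_convex_wrt_imp_subset:
  assumes "properly_quasi_convex_wrt Y T G" and "y \<in> Y"
  shows "T y \<subseteq> G y"
proof -
  have "(\<lambda>_. y) \<in> {1..2::nat} \<rightarrow> Y" using \<open>y \<in> Y\<close> by simp
  moreover have "y \<in> convex hull ((\<lambda>_. y) ` {1..2::nat})" by (intro hull_inc image_eqI[of _ _ 1]) simp_all
  ultimately have "\<exists>i\<in>{1..2::nat}. T y \<subseteq> G y"
    using assms(1)[unfolded properly_quasi_convex_wrt_def, rule_format, of 2 "\<lambda>_. y" y]
    by simp
  then show ?thesis by blast
qed

theorem theorem11:
  fixes X :: "'x topology"
    and Y :: "'y::real_tvs set"
    and T G :: "'y \<Rightarrow> 'x set"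
    and F :: "'x \<times> 'z \<Rightarrow> 'z::real_tvs set"
    and Q :: "'y \<Rightarrow> 'z set"
    and C P :: "'x \<Rightarrow> 'z set"
  assumes "convex Y"
    and "T \<in> KKM Y X"
    and "\<And>A. A \<subseteq> Y \<Longrightarrow> compact A \<Longrightarrow> compactin X (X closure_of (\<Union>(T ` A)))"
    and "F \<in> (topspace X \<times> UNIV) \<rightarrow> (UNIV - {{}})"
    and "\<And>x. x \<in> topspace X \<Longrightarrow>
           pointed (C x) \<and> closed (C x) \<and> convex (C x) \<and> cone (C x) \<and> interior (C x) \<noteq> {}"
    and "\<And>x. x \<in> topspace X \<Longrightarrow> P x = {z. F (x, z) \<subseteq> uminus ` interior (C x)}"
    and "\<And>y. y \<in> Y \<Longrightarrow> G y = {x \<in> topspace X. P x \<inter> Q y = {}}"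
    and "properly_quasi_convex_wrt Y T G"
  shows "\<forall>y\<in>Y. \<exists>x\<in>topspace X. \<forall>z\<in>Q y. \<not> F (x, z) \<subseteq> uminus ` interior (C x)"
proof
  fix y assume y: "y \<in> Y"
  obtain x where "x \<in> T y"
    using KKM_imp_nonempty[OF assms(1,2) y] by blast
  then have "x \<in> G y"
    using properly_quasi_convex_wrt_imp_subset[OF assms(8) y] by blast
  then have x: "x \<in> topspace X" and "P x \<inter> Q y = {}"
    using assms(7)[OF y] by auto
  then have "\<forall>z\<in>Q y. \<not> F (x, z) \<subseteq> uminus ` interior (C x)"
    using assms(6)[OF x] by blast
  with x show "\<exists>x\<in>topspace X. \<forall>z\<in>Q y. \<not> F (x, z) \<subseteq> uminus ` interior (C x)"
    by blast
qed

end
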